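(* Let $X$ be a finite set with $n$ elements and $f\colon X\to X$ a map, whose functional graph has connected components $T_1,\ldots,T_s$ of sizes $t_1,\ldots,t_s$, where $T_i$ contains the cycle $C_i$ of size $c_i$. Let $k$ be an integer with $k\ge 4n\ge 77$. Then: (i) $|H_{f,k}-H_{f,\infty}|\le \dfrac{4n\log_2 k}{k}$. (ii) If $f$ is a permutation, then $c_i=t_i$ for all $i$, $|H_{f,k}-H_{f,\infty}|\le \dfrac{3n\log_2 n}{k}$, and $$H_{f,\infty}+H^*\Big(\frac{c_1}{n},\ldots,\frac{c_s}{n}\Big)=\log_2 n,$$ where $H^*(c_1/n,\ldots,c_s/n)=\sum_{i}\frac{c_i}{n}\log_2\frac{n}{c_i}$ is the Shannon entropy of the distribution with probabilities $c_1/n,\ldots,c_s/n$. If $f$ is a cyclic permutation, then $H_{f,\infty}=\log_2 n$; if $f$ is the identity, then $H_{f,\infty}=0$. (iii) If $f$ is a permutation and $k$ is an integer multiple of $\mathrm{lcm}(c_1,\ldots,c_s)$, then $H_{f,k}=H_{f,\infty}$. (iv) $0\le H_{f,\infty}\le \log_2 n$, and $H_{f,\infty}=\log_2 n$ if and only if $f$ is a cyclic permutation.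
   Context: The functional graph of $f\colon X\to X$ has node set $X$ and a directed edge from $x$ to $f(x)$; each connected component $T_i$ of the underlying undirected graph contains exactly one cycle $C_i$ (both viewed as subsets of $X$), with $t_i=\#T_i$, $c_i=\#C_i$. For a positive integer $k$ and $x,y\in X$, $N_{f,k}(x,y)=\#\{j: 0\le j<k,\ f^{(j)}(x)=y\}$, where $f^{(j)}$ is the $j$-th iterate ($f^{(0)}=\mathrm{id}$). The iteration entropy is $H_{f,k}=\frac{1}{kn}\sum_{x,y\in X}N_{f,k}(x,y)\log_2\frac{k}{N_{f,k}(x,y)}$ (summands with $N_{f,k}(x,y)=0$ are $0$). The asymptotic iteration entropy is $H_{f,\infty}=\frac1n\sum_{1\le i\le s}t_i\log_2 c_i$. *)

theory Defs
  imports Complex_Main "HOL-Combinatorics.Orbits" "Graph_Theory.Digraph_Component"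
begin

text \<open>
  A self-map of a finite set \<open>X\<close> is a function \<open>f :: 'a \<Rightarrow> 'a\<close> with \<open>f \<in> X \<rightarrow> X\<close>; its values outside
  \<open>X\<close> never matter.
\<close>

definition functional_graph :: "'a set \<Rightarrow> ('a \<Rightarrow> 'a) \<Rightarrow> 'a pair_pre_digraph" where
  "functional_graph X f = \<lparr> pverts = X, parcs = {(x, f x) | x. x \<in> X} \<rparr>"

text \<open>
  The connected components of the underlying undirected graph, as sets of nodes: the strong
  components of the symmetrised digraph.
\<close>
definition components :: "'a set \<Rightarrow> ('a \<Rightarrow> 'a) \<Rightarrow> 'a set set" where
  "components X f = pre_digraph.sccs_verts (mk_symmetric (functional_graph X f))"

text \<open>
  The node sets of the directed cycles. A cycle \<open>p\<close> is a list of arcs, which are pairs of nodes;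
  loops are cycles of length 1.
\<close>
definition cycle_sets :: "'a set \<Rightarrow> ('a \<Rightarrow> 'a) \<Rightarrow> 'a set set" where
  "cycle_sets X f = {fst ` set p | p. pre_digraph.cycle (functional_graph X f) p}"

text \<open>
  The unique cycle of the component \<open>T\<close>; the lemma \<open>ex1_component_cycle\<close> below justifies the
  definite description.
\<close>
definition component_cycle :: "'a set \<Rightarrow> ('a \<Rightarrow> 'a) \<Rightarrow> 'a set \<Rightarrow> 'a set" where
  "component_cycle X f T = (THE C. C \<in> cycle_sets X f \<and> C \<subseteq> T)"

definition visits :: "('a \<Rightarrow> 'a) \<Rightarrow> nat \<Rightarrow> 'a \<Rightarrow> 'a \<Rightarrow> nat" where
  "visits f k x y = card {j. j < k \<and> (f ^^ j) x = y}"

text \<open>Summands with \<open>visits f k x y = 0\<close> vanish because of the factor \<open>real (visits f k x y)\<close>.\<close>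
definition iter_entropy :: "'a set \<Rightarrow> ('a \<Rightarrow> 'a) \<Rightarrow> nat \<Rightarrow> real" where
  "iter_entropy X f k =
     1 / (real k * real (card X)) *
       (\<Sum>x\<in>X. \<Sum>y\<in>X. real (visits f k x y) * log 2 (real k / real (visits f k x y)))"

definition asymp_iter_entropy :: "'a set \<Rightarrow> ('a \<Rightarrow> 'a) \<Rightarrow> real" where
  "asymp_iter_entropy X f =
     1 / real (card X) *
       (\<Sum>T\<in>components X f. real (card T) * log 2 (real (card (component_cycle X f T))))"

text \<open>The Shannon entropy of the probabilities \<open>p i\<close>, where \<open>i\<close> ranges over the finite set \<open>I\<close>.\<close>
definition shannon_entropy :: "'i set \<Rightarrow> ('i \<Rightarrow> real) \<Rightarrow> real" where
  "shannon_entropy I p = (\<Sum>i\<in>I. p i * log 2 (1 / p i))"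


subsection \<open>Each component contains exactly one cycle\<close>

lemma awalk_functional_graph_iff:
  assumes "f \<in> X \<rightarrow> X"
  shows "pre_digraph.awalk (functional_graph X f) u p v \<longleftrightarrow>
    u \<in> X \<and> p = map (\<lambda>i. ((f ^^ i) u, (f ^^ Suc i) u)) [0..<length p] \<and> v = (f ^^ length p) u"
proof (induction p arbitrary: u)
  case Nil
  then show ?case
    by (auto simp: pre_digraph.awalk_def pre_digraph.cas.simps functional_graph_def)
next
  case (Cons e p)
  have 1: "pre_digraph.awalk (functional_graph X f) u (e # p) v \<longleftrightarrow>
      u \<in> X \<and> e = (u, f u) \<and> pre_digraph.awalk (functional_graph X f) (f u) p v"
    using assms
    by (auto simp: pre_digraph.awalk_def pre_digraph.cas.simps functional_graph_def)
  have 2: "map (\<lambda>i. ((f ^^ i) u, (f ^^ Suc i) u)) [0..<length (e # p)] =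
      (u, f u) # map (\<lambda>i. ((f ^^ i) (f u), (f ^^ Suc i) (f u))) [0..<length p]"
    by (simp add: upt_conv_Cons map_Suc_upt[symmetric] funpow_swap1 del: upt_Suc)
  have 3: "(f ^^ length (e # p)) u = (f ^^ length p) (f u)"
    by (simp add: funpow_swap1)
  show ?case unfolding 1 2 3 Cons.IH using assms by auto
qed

lemma cycle_sets_eq_orbits:
  assumes f: "f \<in> X \<rightarrow> X"
  shows "cycle_sets X f = {orbit f x | x. x \<in> X \<and> x \<in> orbit f x}"
proof (intro equalityI subsetI)
  fix C assume "C \<in> cycle_sets X f"
  then obtain p u where C: "C = fst ` set p" and "p \<noteq> []"
    and "pre_digraph.awalk (functional_graph X f) u p u"
    by (auto simp: cycle_sets_def pre_digraph.cycle_def)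
  then have u: "u \<in> X" "(f ^^ length p) u = u" "0 < length p"
    and p: "p = map (\<lambda>i. ((f ^^ i) u, (f ^^ Suc i) u)) [0..<length p]"
    by (simp_all add: awalk_functional_graph_iff[OF f])
  have "C = (\<lambda>i. (f ^^ i) u) ` {0..<length p}"
    unfolding C by (subst p) (simp add: image_image)
  also have "\<dots> = orbit f u"
    using orbit_altdef_bounded[OF u(2,3)] by auto
  finally have "C = orbit f u" .
  moreover have "u \<in> orbit f u"
    unfolding orbit_altdef using u by (metis (mono_tags, lifting) mem_Collect_eq)
  ultimately show "C \<in> {orbit f x | x. x \<in> X \<and> x \<in> orbit f x}" using u by blast
next
  fix C assume "C \<in> {orbit f x | x. x \<in> X \<and> x \<in> orbit f x}"
  then obtain u where u: "u \<in> X" "u \<in> orbit f u" "C = orbit f u" by auto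
  define m where "m = (LEAST m. 0 < m \<and> (f ^^ m) u = u)"
  have "\<exists>m. 0 < m \<and> (f ^^ m) u = u" using u(2) by (force simp: orbit_altdef)
  then have m: "0 < m" "(f ^^ m) u = u" unfolding m_def by (metis (mono_tags, lifting) LeastI)+
  have least: "m \<le> l" if "0 < l" "(f ^^ l) u = u" for l
    unfolding m_def using that by (simp add: Least_le)
  have ne: "(f ^^ Suc i) u \<noteq> (f ^^ Suc j) u" if "i < j" "j < m" for i j
  proof
    assume eq: "(f ^^ Suc i) u = (f ^^ Suc j) u"
    have "(f ^^ (m - Suc j + Suc i)) u = (f ^^ (m - Suc j + Suc j)) u"
      unfolding funpow_add comp_def eq ..
    then have "(f ^^ (m - Suc j + Suc i)) u = u" using that m by simp
    from least[OF _ this] that show False by simp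
  qed
  define p where "p = map (\<lambda>i. ((f ^^ i) u, (f ^^ Suc i) u)) [0..<m]"
  have len: "length p = m" by (simp add: p_def)
  have aw: "pre_digraph.awalk (functional_graph X f) u p u"
    unfolding awalk_functional_graph_iff[OF f] len using u(1) m p_def by auto
  have "tl (pre_digraph.awalk_verts (functional_graph X f) u p) = map snd p"
    using aw m len
    by (subst pre_digraph.awalk_verts_conv'[where v = u])
      (auto simp: pre_digraph.awalk_def)
  moreover have "distinct (map snd p)"
    by (auto simp: distinct_conv_nth p_def simp del: funpow.simps) (metis linorder_neqE_nat ne)
  ultimately have "pre_digraph.cycle (functional_graph X f) p"
    using aw m len by (auto simp: pre_digraph.cycle_def)
  moreover have "fst ` set p = orbit f u"
    using orbit_altdef_bounded[OF m(2,1)] by (auto simp: p_def image_image)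
  ultimately show "C \<in> cycle_sets X f" unfolding cycle_sets_def u(3) by blast
qed

lemma rtrancl_imp_meet:
  assumes "(x, y) \<in> {(a, b). b = f a \<or> a = f b}\<^sup>*"
  shows "\<exists>m l. (f ^^ m) x = (f ^^ l) y"
  using assms
proof (induction rule: rtrancl_induct)
  case base
  then show ?case by blast
next
  case (step y z)
  then obtain m l where ml: "(f ^^ m) x = (f ^^ l) y" by blast
  from step.hyps(2) consider "z = f y" | "y = f z" by auto
  then show ?case
  proof cases
    case 1
    have "(f ^^ Suc m) x = (f ^^ l) z" using ml 1 by (simp add: funpow_swap1)
    then show ?thesis by blast
  next
    case 2
    have "(f ^^ m) x = (f ^^ Suc l) z" using ml 2 by (simp add: funpow_swap1)
    then show ?thesis by blast
  qed
qed

lemma ex1_component_cycle: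
  assumes "finite X" and f: "f \<in> X \<rightarrow> X" and T: "T \<in> components X f"
  shows "\<exists>!C. C \<in> cycle_sets X f \<and> C \<subseteq> T"
proof -
  let ?G = "with_proj (mk_symmetric (functional_graph X f))"
  have wf: "wf_digraph ?G"
    by unfold_locales (use f in \<open>auto simp: functional_graph_def parcs_mk_symmetric\<close>)
  have verts: "verts ?G = X" by (simp add: functional_graph_def)
  have arcs: "arcs_ends ?G \<subseteq> {(a, b). b = f a \<or> a = f b}"
    by (auto simp: functional_graph_def parcs_mk_symmetric)
  have Tne: "T \<noteq> {}" and conn: "\<And>u v. u \<in> T \<Longrightarrow> v \<in> T \<Longrightarrow> u \<rightarrow>\<^sup>*\<^bsub>?G\<^esub> v"
    and TX: "T \<subseteq> X"
    using T wf_digraph.sccs_verts_subsets[OF wf] verts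
    by (auto simp: components_def pre_digraph.sccs_verts_def)
  have step: "f u \<in> T" if "u \<in> T" for u
  proof -
    have uX: "u \<in> X" using TX that by auto
    have "(u, f u) \<in> arcs_ends ?G" "(f u, u) \<in> arcs_ends ?G"
      using uX by (auto simp: functional_graph_def parcs_mk_symmetric)
    then have "u \<rightarrow>\<^sup>*\<^bsub>?G\<^esub> f u" "f u \<rightarrow>\<^sup>*\<^bsub>?G\<^esub> u"
      by (auto intro: wf_digraph.reachable_adjI[OF wf])
    then show ?thesis
      using T that unfolding components_def pre_digraph.sccs_verts_def by blast
  qed
  have iter: "(f ^^ i) u \<in> T" if "u \<in> T" for i u
    using that step by (induction i) auto
  have orbT: "orbit f u \<subseteq> T" if "u \<in> T" for u
    using iter[OF that] by (auto simp: orbit_altdef)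
  from Tne obtain u where u: "u \<in> T" by blast
  have "finite T" using TX \<open>finite X\<close> finite_subset by blast
  then have "\<not> inj (\<lambda>i. (f ^^ i) u)"
    using iter[OF u] by (meson finite_subset image_subset_iff infinite_UNIV_nat finite_imageD)
  then obtain i j where ij: "i < j" "(f ^^ i) u = (f ^^ j) u"
    unfolding inj_def by (metis linorder_neqE_nat)
  define w where "w = (f ^^ i) u"
  have "(f ^^ (j - i)) w = (f ^^ (j - i + i)) u" unfolding w_def funpow_add by simp
  also have "\<dots> = w" using ij by (simp add: w_def)
  finally have "w \<in> orbit f w" unfolding orbit_altdef using ij(1)
    by (metis (mono_tags, lifting) mem_Collect_eq zero_less_diff)
  moreover have "w \<in> T" unfolding w_def by (rule iter[OF u])
  ultimately have ex: "orbit f w \<in> cycle_sets X f \<and> orbit f w \<subseteq> T"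
    using orbT TX by (auto simp: cycle_sets_eq_orbits[OF f])
  moreover have "C = orbit f w" if C: "C \<in> cycle_sets X f \<and> C \<subseteq> T" for C
  proof -
    obtain x where x: "x \<in> orbit f x" "C = orbit f x"
      using C by (auto simp: cycle_sets_eq_orbits[OF f])
    then have "x \<rightarrow>\<^sup>*\<^bsub>?G\<^esub> w" using C conn \<open>w \<in> T\<close> by blast
    then have "(x, w) \<in> {(a, b). b = f a \<or> a = f b}\<^sup>*"
      using arcs by (meson reachable_def rtrancl_mono rtrancl_on_rtranclI subsetD)
    from rtrancl_imp_meet[OF this] obtain m l where ml: "(f ^^ m) x = (f ^^ l) w" by blast
    define z where "z = (f ^^ m) x"
    have "z \<in> orbit f x" unfolding z_def by (rule funpow_in_orbit[OF x(1)])
    moreover have "z \<in> orbit f w" unfolding z_def ml by (rule funpow_in_orbit[OF \<open>w \<in> orbit f w\<close>])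
    ultimately have "orbit f x = orbit f z" "orbit f w = orbit f z"
      using x(1) \<open>w \<in> orbit f w\<close> by (blast intro: orbit_swap orbit_trans)+
    then show ?thesis using x by simp
  qed
  ultimately show ?thesis by blast
qed

end

(*
  All estimates hold point by point: iter_entropy and asymp_iter_entropy are averages over x of the
  entropy of the distribution visits f k x _ / k and of log 2 c, where c is the length of the cycle
  C that the path of x runs into. Since the path returns to a point of C every c steps and visits
  the other points at most once, every point is visited at most k/c + 1 times, which bounds the
  entropy from below by log 2 c - log 2 (1 + c/k). From above, Gibbs' inequality on C and the
  trivial bound log 2 k for each of the other points give an error of order (n * log 2 k) / k; these
  other points do not exist for permutations.
*)

theory Submission
  imports Defs
begin

section \<open>Entropy estimates for integer weights\<close>

lemma ln_2_ge_half: "1 / 2 \<le> ln (2 :: real)"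
proof -
  have "ln (exp 1) \<le> ln (2 ^ 2 :: real)"
    using exp_le by (subst ln_le_cancel_iff) auto
  also have "\<dots> = 2 * ln 2"
    by (simp only: ln_realpow zero_less_numeral)
  finally show ?thesis by simp
qed

text \<open>The tangent bound for \<open>ln\<close> produces errors divided by \<open>ln 2\<close>;
  since 1 / \<open>ln 2\<close> is at most 2, they become the integer constants of the final
  estimates.\<close>

lemma div_ln_2_le:
  assumes "0 \<le> (x :: real)"
  shows "x / ln 2 \<le> 2 * x"
proof -
  have "x * 1 \<le> x * (2 * ln 2)"
    using assms ln_2_ge_half by (intro mult_left_mono) auto
  then show ?thesis by (simp add: divide_le_eq mult_ac)
qed

text \<open>The left side replaces each \<open>N y\<close> inside the logarithm by its upper bound
  \<open>M\<close>; the weights \<open>N y\<close> then sum to \<open>k\<close>. In other words,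
  Shannon entropy is at least min-entropy. \<open>M\<close> is real because it will be k/c + 1 or
  k/c.\<close>

lemma sum_log_ratio_ge:
  fixes N :: "'b \<Rightarrow> nat"
  assumes "0 < k" and k: "(\<Sum>y\<in>X. N y) = k" and M: "0 < M" "\<And>y. y \<in> X \<Longrightarrow> real (N y) \<le> M"
  shows "real k * log 2 (real k / M) \<le> (\<Sum>y\<in>X. real (N y) * log 2 (real k / real (N y)))"
proof -
  have "real (N y) * log 2 (real k / M) \<le> real (N y) * log 2 (real k / real (N y))"
    if "y \<in> X" for y
  proof (cases "N y = 0")
    case False
    then show ?thesis
      using M(2)[OF that] \<open>0 < M\<close> \<open>0 < k\<close>
      by (intro mult_left_mono) (simp_all add: frac_le)
  qed simp
  then have "(\<Sum>y\<in>X. real (N y) * log 2 (real k / M))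
      \<le> (\<Sum>y\<in>X. real (N y) * log 2 (real k / real (N y)))"
    by (rule sum_mono)
  then show ?thesis
    by (simp add: k flip: sum_distrib_right of_nat_sum)
qed

text \<open>Gibbs' inequality compares \<open>N\<close> on \<open>C\<close> with the uniform weight
  k/c. As \<open>N\<close> has only mass k - R there, the linear correction is R /
  \<open>ln 2\<close>, at most 2R. Every unit of the remaining mass R costs log k.\<close>

lemma sum_log_ratio_le:
  fixes N :: "'b \<Rightarrow> nat"
  assumes X: "finite X" "C \<subseteq> X" "C \<noteq> {}" and "0 < k" and k: "(\<Sum>y\<in>X. N y) = k"
    and off: "\<And>y. y \<in> X - C \<Longrightarrow> N y \<le> 1"
  shows "(\<Sum>y\<in>X. real (N y) * log 2 (real k / real (N y)))
    \<le> real k * log 2 (real (card C)) + real (\<Sum>y\<in>X - C. N y) * (log 2 (real k) + 2)"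
proof -
  define c where "c = card C"
  define R where "R = (\<Sum>y\<in>X - C. N y)"
  have "0 < c"
    using X finite_subset by (auto simp: c_def card_gt_0_iff)
  have split: "(\<Sum>y\<in>C. N y) + R = k"
    unfolding R_def k[symmetric] by (simp add: sum.subset_diff[OF X(2,1)] add.commute)
  then have splitR: "real (\<Sum>y\<in>C. N y) = real k - real R"
    by linarith
  \<comment> \<open>This is ln t \<le> t - 1 at t = k / (c * N y), multiplied by \<open>N y\<close>.
    If \<open>N y\<close> is 0, the right side is k / (c * \<open>ln 2\<close>), still
    nonnegative.\<close>
  have on: "real (N y) * log 2 (real k / real (N y))
      \<le> real (N y) * log 2 (real c) + (real k / real c - real (N y)) / ln 2" for y
  proof (cases "N y = 0")
    case False
    have "ln (real k / (real c * real (N y))) \<le> real k / (real c * real (N y)) - 1"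
      using False \<open>0 < c\<close> \<open>0 < k\<close> by (intro ln_le_minus_one) simp
    then have "log 2 (real k / (real c * real (N y))) \<le> (real k / (real c * real (N y)) - 1) / ln 2"
      by (simp add: log_def divide_right_mono)
    then have "real (N y) * log 2 (real k / (real c * real (N y)))
        \<le> real (N y) * ((real k / (real c * real (N y)) - 1) / ln 2)"
      by (rule mult_left_mono) simp
    also have "\<dots> = (real k / real c - real (N y)) / ln 2"
      using False \<open>0 < c\<close> by (simp add: field_simps)
    finally show ?thesis
      using False \<open>0 < c\<close> \<open>0 < k\<close> by (simp add: log_divide log_mult algebra_simps)
  qed simp
  have "(\<Sum>y\<in>C. real (N y) * log 2 (real k / real (N y)))
      \<le> (\<Sum>y\<in>C. real (N y) * log 2 (real c) + (real k / real c - real (N y)) / ln 2)"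
    using on by (rule sum_mono)
  also have "\<dots> = real (\<Sum>y\<in>C. N y) * log 2 (real c)
      + (real c * (real k / real c) - real (\<Sum>y\<in>C. N y)) / ln 2"
    by (simp add: sum.distrib sum_distrib_right sum_subtractf c_def flip: sum_divide_distrib)
  also have "\<dots> = real (\<Sum>y\<in>C. N y) * log 2 (real c) + real R / ln 2"
    unfolding splitR using \<open>0 < c\<close> by simp
  also have "\<dots> \<le> real k * log 2 (real c) + 2 * real R"
    using \<open>0 < c\<close> div_ln_2_le[of "real R"] split by (intro add_mono mult_right_mono) auto
  finally have C: "(\<Sum>y\<in>C. real (N y) * log 2 (real k / real (N y)))
      \<le> real k * log 2 (real c) + 2 * real R" .
  \<comment> \<open>Off \<open>C\<close> the count is 0 or 1, and log (k / 1) = log k.\<close>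
  have "real (N y) * log 2 (real k / real (N y)) = real (N y) * log 2 (real k)"
    if "y \<in> X - C" for y
    using off[OF that] by (cases "N y = 0") (auto simp: le_Suc_eq)
  then have "(\<Sum>y\<in>X - C. real (N y) * log 2 (real k / real (N y))) = real R * log 2 (real k)"
    unfolding R_def of_nat_sum sum_distrib_right by (rule sum.cong[OF refl])
  with C show ?thesis
    unfolding c_def R_def sum.subset_diff[OF X(2,1)] by (simp add: algebra_simps)
qed


section \<open>Visits to periodic and non-periodic points\<close>

text \<open>The orbit of a periodic point has as many elements as its least period m. The remainder
  \<open>d mod m\<close> would be a smaller positive period unless it is 0.\<close>

lemma card_orbit_dvd:
  assumes d: "(f ^^ d) y = y" "0 < d"
  shows "card (orbit f y) dvd d"
proof -
  define m where "m = funpow_dist1 f y y"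
  have self: "y \<in> orbit f y"
    unfolding orbit_altdef using d by (metis (mono_tags, lifting) mem_Collect_eq)
  have "card (orbit f y) = m"
    unfolding orbit_conv_funpow_dist1[OF self] m_def
    by (simp only: card_image[OF inj_on_funpow_dist1[OF self]] card_atLeastLessThan)
  moreover have "(f ^^ m) y = y"
    unfolding m_def by (rule funpow_dist1_prop[OF self])
  then have "(f ^^ (d mod m)) y = y"
    using d by (simp add: funpow_mod_eq)
  then have "\<not> 0 < d mod m"
    using funpow_dist1_least[of "d mod m" f y y] by (auto simp: m_def)
  ultimately show ?thesis by auto
qed

text \<open>Within one residue class a number is determined by its quotient by \<open>c\<close>. The
  quotients lie in 0, ..., \<open>k div c\<close>, and the last value is excluded when
  \<open>c\<close> divides \<open>k\<close>.\<close>

lemma card_cong_class_le: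
  fixes c :: nat
  assumes J: "J \<subseteq> {..<k}" and "0 < c" and cong: "\<And>i j. i \<in> J \<Longrightarrow> j \<in> J \<Longrightarrow> i mod c = j mod c"
  shows "real (card J) \<le> real k / real c + 1" and "c dvd k \<Longrightarrow> real (card J) \<le> real k / real c"
proof -
  have inj: "inj_on (\<lambda>j. j div c) J"
    by (rule inj_onI) (metis cong div_mult_mod_eq)
  have "(\<lambda>j. j div c) ` J \<subseteq> {..k div c}"
    using J by (auto intro: div_le_mono less_imp_le)
  from card_inj_on_le[OF inj this] have "card J \<le> k div c + 1" by simp
  then have "real (card J) \<le> real (k div c) + 1" by linarith
  also have "\<dots> \<le> real k / real c + 1"
    using of_nat_div_le_of_nat[of k c] by simp
  finally show "real (card J) \<le> real k / real c + 1" .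
  assume dvd: "c dvd k"
  then have "(\<lambda>j. j div c) ` J \<subseteq> {..<k div c}"
    using J \<open>0 < c\<close> by (auto simp: div_less_iff_less_mult)
  from card_inj_on_le[OF inj this] have "card J \<le> k div c" by simp
  then show "real (card J) \<le> real k / real c"
    using dvd by (simp flip: real_of_nat_div)
qed

lemma funpow_eq_imp_period:
  assumes "(f ^^ i) x = y" "(f ^^ j) x = y" "i \<le> j"
  shows "(f ^^ (j - i)) y = y"
  using assms funpow_add[of "j - i" i f] by simp

text \<open>Two times at which the path of \<open>x\<close> is at \<open>y\<close> differ by a
  period of \<open>y\<close>, so all visits fall into one residue class modulo \<open>c\<close>. The
  start \<open>x\<close> may lie outside the cycle.\<close>

lemma visits_periodic_le:
  fixes f :: "'a \<Rightarrow> 'a"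
  assumes y: "y \<in> orbit f y"
  defines "c \<equiv> card (orbit f y)"
  shows "real (visits f k x y) \<le> real k / real c + 1"
    and "c dvd k \<Longrightarrow> real (visits f k x y) \<le> real k / real c"
proof -
  have "0 < c"
    unfolding c_def using y finite_orbit[OF y] by (auto simp: card_gt_0_iff)
  have le: "i mod c = j mod c" if ij: "(f ^^ i) x = y" "(f ^^ j) x = y" "i \<le> j" for i j
  proof (cases "i = j")
    case False
    then have "c dvd j - i"
      unfolding c_def using ij funpow_eq_imp_period[OF ij] by (intro card_orbit_dvd) auto
    then show ?thesis using ij(3) by (metis mod_eq_dvd_iff_nat)
  qed simp
  have cong: "i mod c = j mod c"
    if "i \<in> {j. j < k \<and> (f ^^ j) x = y}" "j \<in> {j. j < k \<and> (f ^^ j) x = y}" for i j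
    using that le[of i j] le[of j i, symmetric] nat_le_linear[of i j] by blast
  show "real (visits f k x y) \<le> real k / real c + 1"
    unfolding visits_def by (rule card_cong_class_le(1)[OF _ \<open>0 < c\<close> cong]) auto
  show "real (visits f k x y) \<le> real k / real c" if "c dvd k"
    unfolding visits_def by (rule card_cong_class_le(2)[OF _ \<open>0 < c\<close> cong that]) auto
qed

text \<open>A second visit makes \<open>y\<close> periodic and occurs at a positive time. Positivity
  matters because \<open>orbit f x\<close> consists of the positive iterates only.\<close>

lemma visits_le_1:
  assumes "\<not> (y \<in> orbit f x \<and> y \<in> orbit f y)"
  shows "visits f k x y \<le> 1"
proof -
  have "i = j" if ij: "(f ^^ i) x = y" "(f ^^ j) x = y" "i \<le> j" for i j
  proof (rule ccontr)
    assume "i \<noteq> j"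
    then have "0 < j" "0 < j - i" using ij by auto
    then have "y \<in> orbit f x" "y \<in> orbit f y"
      using ij(2) funpow_eq_imp_period[OF ij] by (auto simp only: orbit_altdef) metis+
    with assms show False by blast
  qed
  then have "\<forall>i\<in>{j. j < k \<and> (f ^^ j) x = y}. \<forall>j\<in>{j. j < k \<and> (f ^^ j) x = y}. i = j"
    by (metis (mono_tags, lifting) mem_Collect_eq nat_le_linear)
  then show ?thesis
    by (simp add: visits_def card_le_Suc0_iff_eq)
qed


section \<open>Components and their cycles\<close>

locale finite_self_map =
  fixes X :: "'a set" and f :: "'a \<Rightarrow> 'a"
  assumes finite_X: "finite X" and f_in: "f \<in> X \<rightarrow> X"
begin

abbreviation sym_graph :: "'a pair_pre_digraph" where
  "sym_graph \<equiv> mk_symmetric (functional_graph X f)"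

lemma wf_sym_graph: "wf_digraph (with_proj sym_graph)"
  by unfold_locales (use f_in in \<open>auto simp: functional_graph_def parcs_mk_symmetric\<close>)

lemma Union_components: "\<Union> (components X f) = X"
proof -
  have "verts (with_proj sym_graph) = X"
    by (simp add: functional_graph_def)
  then show ?thesis
    using wf_digraph.sccs_verts_subsets[OF wf_sym_graph]
      wf_digraph.scc_of_in_sccs_verts[OF wf_sym_graph] wf_digraph.in_scc_of_self[OF wf_sym_graph]
    unfolding components_def by fast
qed

lemma component_subset: "T \<in> components X f \<Longrightarrow> T \<subseteq> X"
  using Union_components by blast

lemma finite_component: "T \<in> components X f \<Longrightarrow> finite T"
  using component_subset finite_X finite_subset by blast

lemma finite_components: "finite (components X f)"
  using Union_components finite_X by (simp add: finite_UnionD)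

lemma components_disjoint:
  "S \<in> components X f \<Longrightarrow> T \<in> components X f \<Longrightarrow> S \<noteq> T \<Longrightarrow> S \<inter> T = {}"
  unfolding components_def by (rule wf_digraph.sccs_verts_disjoint[OF wf_sym_graph])

lemma component_nonempty: "T \<in> components X f \<Longrightarrow> T \<noteq> {}"
  by (auto simp: components_def pre_digraph.sccs_verts_def)

lemma sum_components:
  "(\<Sum>T\<in>components X f. \<Sum>x\<in>T. g x) = (\<Sum>x\<in>X. g x)"
proof -
  have "sum g (\<Union> (components X f)) = (\<Sum>T\<in>components X f. sum g T)"
    using components_disjoint finite_component
    by (subst sum.Union_disjoint) auto
  then show ?thesis by (simp add: Union_components)
qed

text \<open>Symmetrisation supplies the arc back from \<open>f x\<close> to \<open>x\<close>, and a
  strong component contains every node mutually reachable with one of its members.\<close>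

lemma component_step:
  assumes "T \<in> components X f" "x \<in> T"
  shows "f x \<in> T"
proof -
  have "x \<in> X" using assms component_subset by auto
  then have "(x, f x) \<in> arcs_ends (with_proj sym_graph)" "(f x, x) \<in> arcs_ends (with_proj sym_graph)"
    by (auto simp: functional_graph_def parcs_mk_symmetric)
  then have "x \<rightarrow>\<^sup>*\<^bsub>with_proj sym_graph\<^esub> f x" "f x \<rightarrow>\<^sup>*\<^bsub>with_proj sym_graph\<^esub> x"
    by (auto intro: wf_digraph.reachable_adjI[OF wf_sym_graph])
  then show ?thesis
    using assms unfolding components_def pre_digraph.sccs_verts_def by blast
qed

lemma component_funpow: "T \<in> components X f \<Longrightarrow> x \<in> T \<Longrightarrow> (f ^^ i) x \<in> T"
  by (induction i) (auto intro: component_step)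

lemma orbit_subset_component: "T \<in> components X f \<Longrightarrow> x \<in> T \<Longrightarrow> orbit f x \<subseteq> T"
  by (auto simp: orbit_altdef component_funpow)

lemma component_cycle:
  assumes "T \<in> components X f"
  shows "component_cycle X f T \<in> cycle_sets X f" "component_cycle X f T \<subseteq> T"
  using theI'[OF ex1_component_cycle[OF finite_X f_in assms]] by (auto simp: component_cycle_def)

text \<open>The orbit of a periodic point of \<open>T\<close> is a cycle inside \<open>T\<close>,
  and there is only one such cycle.\<close>

lemma component_cycle_eqI:
  assumes "T \<in> components X f" "x \<in> T" "x \<in> orbit f x"
  shows "component_cycle X f T = orbit f x"
proof -
  have "orbit f x \<in> cycle_sets X f \<and> orbit f x \<subseteq> T"
    using assms component_subset orbit_subset_component
    unfolding cycle_sets_eq_orbits[OF f_in] by blast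
  then show ?thesis
    unfolding component_cycle_def using ex1_component_cycle[OF finite_X f_in assms(1)]
    by (intro the1_equality) auto
qed

lemma component_cycle_self_orbit:
  assumes "T \<in> components X f" "y \<in> component_cycle X f T"
  shows "y \<in> orbit f y"
  using component_cycle(1)[OF assms(1)] assms(2) self_in_orbit_trans
  unfolding cycle_sets_eq_orbits[OF f_in] by fastforce

lemma component_cycle_nonempty:
  assumes "T \<in> components X f"
  shows "component_cycle X f T \<noteq> {}"
  using component_cycle(1)[OF assms] unfolding cycle_sets_eq_orbits[OF f_in]
  by (auto simp: orbit_nonempty)

lemma card_component_cycle:
  assumes "T \<in> components X f"
  shows "1 \<le> card (component_cycle X f T)" "card (component_cycle X f T) \<le> card T"
    "card T \<le> card X"
  using component_cycle[OF assms] component_cycle_nonempty[OF assms] finite_component[OF assms]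
    finite_X component_subset[OF assms]
  by (auto intro: card_mono simp: Suc_le_eq card_gt_0_iff finite_subset)

text \<open>Extending \<open>f\<close> by the identity outside \<open>X\<close> gives a permutation
  of the whole type, in which every point lies in its own orbit. The path from \<open>x\<close>
  stays in \<open>X\<close>, so the extension does not change its orbit.\<close>

lemma bij_self_in_orbit:
  assumes "bij_betw f X X" "x \<in> X"
  shows "x \<in> orbit f x"
proof -
  let ?g = "\<lambda>y. if y \<in> X then f y else y"
  have "bij_betw ?g X X"
    using assms(1) by (simp cong: bij_betw_cong)
  then have "?g permutes X"
    by (rule bij_imp_permutes) simp
  then have "x \<in> orbit ?g x"
    using finite_X by (intro permutation_self_in_orbit) (auto simp: permutation_permutes)
  also have "orbit ?g x = orbit f x"
    using assms(2) f_in by (intro orbit_cong0[of x X]) auto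
  finally show ?thesis .
qed

lemma component_cycle_bij:
  assumes "bij_betw f X X" and T: "T \<in> components X f"
  shows "component_cycle X f T = T"
proof
  show "T \<subseteq> component_cycle X f T"
  proof
    fix x assume "x \<in> T"
    moreover from this have "x \<in> orbit f x"
      using component_subset[OF T] by (intro bij_self_in_orbit[OF assms(1)]) auto
    ultimately show "x \<in> component_cycle X f T"
      using component_cycle_eqI[OF T] by auto
  qed
qed (rule component_cycle(2)[OF T])


section \<open>The entropy of a single path\<close>

definition path_entropy :: "nat \<Rightarrow> 'a \<Rightarrow> real" where
  "path_entropy k x =
     (\<Sum>y\<in>X. real (visits f k x y) * log 2 (real k / real (visits f k x y))) / real k"

lemma iter_entropy_eq:
  "iter_entropy X f k = (\<Sum>T\<in>components X f. \<Sum>x\<in>T. path_entropy k x) / real (card X)"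
  by (simp add: sum_components iter_entropy_def path_entropy_def sum_divide_distrib)

text \<open>Both entropies are averages over the points of \<open>X\<close>: the factor
  \<open>card T\<close> in the asymptotic one counts the starting points in \<open>T\<close>. A
  uniform pointwise error therefore carries over to the averages.\<close>

lemma entropy_difference_le:
  assumes "X \<noteq> {}"
    and "\<And>T x. T \<in> components X f \<Longrightarrow> x \<in> T \<Longrightarrow>
      \<bar>path_entropy k x - log 2 (real (card (component_cycle X f T)))\<bar> \<le> b"
  shows "\<bar>iter_entropy X f k - asymp_iter_entropy X f\<bar> \<le> b"
proof -
  have "iter_entropy X f k - asymp_iter_entropy X f =
      (\<Sum>T\<in>components X f. \<Sum>x\<in>T. path_entropy k x - log 2 (real (card (component_cycle X f T))))
      / real (card X)"
    by (simp add: iter_entropy_eq asymp_iter_entropy_def sum_subtractf diff_divide_distrib)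
  then have "\<bar>iter_entropy X f k - asymp_iter_entropy X f\<bar> =
      \<bar>\<Sum>T\<in>components X f. \<Sum>x\<in>T. path_entropy k x - log 2 (real (card (component_cycle X f T)))\<bar>
      / real (card X)"
    by simp
  also have "\<dots> \<le> (\<Sum>T\<in>components X f. \<Sum>x\<in>T. b) / real (card X)"
    using assms(2)
    by (intro divide_right_mono order_trans[OF sum_abs] sum_mono) auto
  also have "\<dots> = b"
    using assms(1) finite_X by (simp only: sum_components) simp
  finally show ?thesis .
qed

text \<open>Each of the \<open>k\<close> times is counted at exactly one \<open>y\<close>, since the
  path never leaves \<open>X\<close>.\<close>

lemma sum_visits:
  assumes "x \<in> X"
  shows "(\<Sum>y\<in>X. visits f k x y) = k"
proof -
  have in_X: "(f ^^ j) x \<in> X" for j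
    using assms f_in by (induction j) auto
  have "(\<Sum>y\<in>X. visits f k x y) = card (\<Union>y\<in>X. {j. j < k \<and> (f ^^ j) x = y})"
    unfolding visits_def using finite_X by (subst card_UN_disjoint) auto
  also have "(\<Union>y\<in>X. {j. j < k \<and> (f ^^ j) x = y}) = {..<k}"
    using in_X by auto
  finally show ?thesis by simp
qed

section \<open>Bounds for one starting point in a fixed component\<close>

context
  fixes T :: "'a set" and x :: 'a and k :: nat and c :: nat
  assumes T: "T \<in> components X f" and x: "x \<in> T" and k: "0 < k"
  defines "c \<equiv> card (component_cycle X f T)"
begin

lemma x_in_X: "x \<in> X"
  using T x component_subset by auto

lemma visits_cycle_le:
  assumes y: "y \<in> component_cycle X f T"
  shows "real (visits f k x y) \<le> real k / real c + 1"
    and "c dvd k \<Longrightarrow> real (visits f k x y) \<le> real k / real c"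
proof -
  have self: "y \<in> orbit f y" using component_cycle_self_orbit[OF T y] .
  moreover have "y \<in> T" using component_cycle(2)[OF T] y by auto
  ultimately have "c = card (orbit f y)"
    unfolding c_def by (simp add: component_cycle_eqI[OF T])
  then show "real (visits f k x y) \<le> real k / real c + 1"
    and "c dvd k \<Longrightarrow> real (visits f k x y) \<le> real k / real c"
    using visits_periodic_le[OF self] by simp_all
qed

lemma visits_off_cycle_le_1:
  assumes "y \<notin> component_cycle X f T"
  shows "visits f k x y \<le> 1"
proof (rule visits_le_1, rule notI)
  assume y: "y \<in> orbit f x \<and> y \<in> orbit f y"
  then have "y \<in> T" using orbit_subset_component[OF T x] by blast
  then show False using assms y component_cycle_eqI[OF T] by blast
qed

lemma visits_off_component:
  assumes "y \<notin> T"
  shows "visits f k x y = 0"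
proof -
  have "{j. j < k \<and> (f ^^ j) x = y} = {}"
    using component_funpow[OF T x] assms by auto
  then show ?thesis unfolding visits_def by simp
qed

lemma c_bounds: "1 \<le> c" "c \<le> card X"
  using card_component_cycle[OF T] unfolding c_def by auto

lemma path_entropy_ge: "log 2 (real c) - 2 * real (card X) / real k \<le> path_entropy k x"
proof -
  \<comment> \<open>Isolates the factor 1 + c/k, whose logarithm is the whole loss against log
    c.\<close>
  have eq: "real k / (real k / real c + 1) = real c / (1 + real c / real k)"
    using k c_bounds by (simp add: field_simps)
  \<comment> \<open>The same bound serves all points: off the cycle there is at most one visit, and
    1 \<le> k/c + 1.\<close>
  have "real (visits f k x y) \<le> real k / real c + 1" for y
    using visits_cycle_le(1)[of y] visits_off_cycle_le_1[of y] c_bounds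
    by (cases "y \<in> component_cycle X f T") (simp_all add: add_increasing)
  then have "real k * log 2 (real k / (real k / real c + 1)) \<le> real k * path_entropy k x"
    using sum_log_ratio_ge[OF k sum_visits[OF x_in_X], of "real k / real c + 1"] k c_bounds
    by (simp add: path_entropy_def add_pos_pos)
  then have "log 2 (real k / (real k / real c + 1)) \<le> path_entropy k x"
    using k by simp
  moreover have "log 2 (real k / (real k / real c + 1)) = log 2 (real c) - log 2 (1 + real c / real k)"
    unfolding eq using c_bounds add_pos_nonneg[of 1 "real c / real k"] by (subst log_divide) auto
  moreover have "log 2 (1 + real c / real k) \<le> (real c / real k) / ln 2"
    unfolding log_def by (intro divide_right_mono ln_add_one_self_le_self) auto
  moreover have "(real c / real k) / ln 2 \<le> 2 * (real c / real k)"
    by (rule div_ln_2_le) simp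
  moreover have "2 * (real c / real k) \<le> 2 * real (card X) / real k"
    using c_bounds by (simp add: divide_right_mono)
  ultimately show ?thesis by linarith
qed

text \<open>The number of visits off the cycle is kept explicit, because it is at most
  \<open>card X\<close> in general but 0 for permutations.\<close>

lemma path_entropy_le_visits:
  "path_entropy k x \<le> log 2 (real c)
    + real (\<Sum>y\<in>X - component_cycle X f T. visits f k x y) * (log 2 (real k) + 2) / real k"
proof -
  have "component_cycle X f T \<subseteq> X"
    using component_cycle(2)[OF T] component_subset[OF T] by blast
  from sum_log_ratio_le[OF finite_X this component_cycle_nonempty[OF T] k sum_visits[OF x_in_X]]
  have "real k * path_entropy k x \<le> real k * log 2 (real c)
    + real (\<Sum>y\<in>X - component_cycle X f T. visits f k x y) * (log 2 (real k) + 2)"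
    using visits_off_cycle_le_1 k by (simp add: path_entropy_def c_def)
  then show ?thesis
    using k by (simp add: field_simps)
qed

lemma path_entropy_le:
  "path_entropy k x \<le> log 2 (real c) + real (card X) * (log 2 (real k) + 2) / real k"
proof -
  have "(\<Sum>y\<in>X - component_cycle X f T. visits f k x y)
      \<le> (\<Sum>y\<in>X - component_cycle X f T. 1)"
    using visits_off_cycle_le_1 by (intro sum_mono) auto
  also have "\<dots> \<le> card X"
    using finite_X by (simp add: card_mono)
  finally have "real (\<Sum>y\<in>X - component_cycle X f T. visits f k x y) * (log 2 (real k) + 2) / real k
      \<le> real (card X) * (log 2 (real k) + 2) / real k"
    using k by (intro divide_right_mono mult_right_mono of_nat_mono) auto
  with path_entropy_le_visits show ?thesis by linarith
qed

section \<open>Sharper bounds for permutations\<close>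

context
  assumes bij: "bij_betw f X X"
begin

text \<open>The cycle is now all of \<open>T\<close>, which the path never leaves, so the error term
  vanishes.\<close>

lemma path_entropy_bij_le: "path_entropy k x \<le> log 2 (real c)"
proof -
  have "(\<Sum>y\<in>X - component_cycle X f T. visits f k x y) = 0"
    using visits_off_component by (simp add: component_cycle_bij[OF bij T])
  with path_entropy_le_visits show ?thesis by simp
qed

text \<open>When \<open>c\<close> divides \<open>k\<close>, the visit bound k/c has no rounding
  term, and the lower bound becomes log (k / (k/c)) = log c.\<close>

lemma path_entropy_bij_eq:
  assumes "c dvd k"
  shows "path_entropy k x = log 2 (real c)"
proof (rule antisym)
  have "real (visits f k x y) \<le> real k / real c" for y
    using visits_cycle_le(2)[OF _ assms, of y] visits_off_component[of y]
    by (cases "y \<in> T") (simp_all add: component_cycle_bij[OF bij T])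
  then have "real k * log 2 (real k / (real k / real c)) \<le> real k * path_entropy k x"
    using sum_log_ratio_ge[OF k sum_visits[OF x_in_X], of "real k / real c"] k c_bounds
    by (simp add: path_entropy_def)
  then show "log 2 (real c) \<le> path_entropy k x"
    using k by simp
qed (rule path_entropy_bij_le)

end

end


section \<open>The iteration entropy and its asymptotic value\<close>

lemma entropy_error:
  assumes "4 \<le> k" "X \<noteq> {}"
  shows "\<bar>iter_entropy X f k - asymp_iter_entropy X f\<bar> \<le> 4 * real (card X) * log 2 (real k) / real k"
proof (rule entropy_difference_le[OF assms(2)])
  fix T x assume T: "T \<in> components X f" "x \<in> T"
  have k: "0 < k" using assms by simp
  \<comment> \<open>With k \<ge> 4, log k is at least 2, so 4 * log k dominates both log k + 2 from
    the upper bound and 2 from the lower bound.\<close>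
  have "log 2 (2 ^ 2) \<le> log 2 (real k)"
    using assms by (subst log_le_cancel_iff) auto
  then have log_k: "2 \<le> log 2 (real k)"
    by (simp only: log_nat_power) simp
  have "real (card X) * (log 2 (real k) + 2) \<le> real (card X) * (4 * log 2 (real k))"
    "real (card X) * 2 \<le> real (card X) * (4 * log 2 (real k))"
    using log_k by (intro mult_left_mono; simp)+
  then have "real (card X) * (log 2 (real k) + 2) / real k \<le> 4 * real (card X) * log 2 (real k) / real k"
    "2 * real (card X) / real k \<le> 4 * real (card X) * log 2 (real k) / real k"
    by (auto intro!: divide_right_mono simp: mult_ac)
  then show "\<bar>path_entropy k x - log 2 (real (card (component_cycle X f T)))\<bar>
      \<le> 4 * real (card X) * log 2 (real k) / real k"
    using path_entropy_ge[OF T k] path_entropy_le[OF T k] by (intro abs_leI) linarith+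
qed

lemma entropy_error_bij:
  assumes "0 < k" "2 \<le> card X" "bij_betw f X X"
  shows "\<bar>iter_entropy X f k - asymp_iter_entropy X f\<bar>
    \<le> 3 * real (card X) * log 2 (real (card X)) / real k"
proof (rule entropy_difference_le)
  show "X \<noteq> {}" using assms by auto
  fix T x assume T: "T \<in> components X f" "x \<in> T"
  have "log 2 2 \<le> log 2 (real (card X))"
    using assms by (subst log_le_cancel_iff) auto
  then have log_n: "1 \<le> log 2 (real (card X))" by simp
  \<comment> \<open>Only the lower bound has an error, 2n/k; it is absorbed because log n \<ge>
    1.\<close>
  have "real (card X) * 2 \<le> real (card X) * (3 * log 2 (real (card X)))"
    using log_n by (intro mult_left_mono) auto
  then have "2 * real (card X) / real k \<le> 3 * real (card X) * log 2 (real (card X)) / real k"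
    by (auto intro!: divide_right_mono simp: mult_ac)
  moreover have "0 \<le> 3 * real (card X) * log 2 (real (card X)) / real k"
    using log_n by simp
  ultimately show "\<bar>path_entropy k x - log 2 (real (card (component_cycle X f T)))\<bar>
      \<le> 3 * real (card X) * log 2 (real (card X)) / real k"
    using path_entropy_ge[OF T assms(1)] path_entropy_bij_le[OF T assms(1,3)]
    by (intro abs_leI) linarith+
qed

lemma entropy_bij_eq:
  assumes "0 < k" "X \<noteq> {}" "bij_betw f X X"
    and dvd: "(LCM T\<in>components X f. card (component_cycle X f T)) dvd k"
  shows "iter_entropy X f k = asymp_iter_entropy X f"
proof -
  have "\<bar>iter_entropy X f k - asymp_iter_entropy X f\<bar> \<le> 0"
  proof (rule entropy_difference_le[OF assms(2)])
    fix T x assume T: "T \<in> components X f" "x \<in> T"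
    then have "card (component_cycle X f T) dvd k"
      using dvd by (meson dvd_Lcm dvd_trans imageI)
    then show "\<bar>path_entropy k x - log 2 (real (card (component_cycle X f T)))\<bar> \<le> 0"
      using path_entropy_bij_eq[OF T assms(1,3)] by simp
  qed
  then show ?thesis by simp
qed

section \<open>Special values, range and extremal case of the asymptotic entropy\<close>

lemma sum_card_components: "(\<Sum>T\<in>components X f. real (card T)) = real (card X)"
  using sum_components[of "\<lambda>_. 1 :: real"] by simp

lemma asymp_entropy_const:
  assumes "\<And>T. T \<in> components X f \<Longrightarrow> card (component_cycle X f T) = c" "X \<noteq> {}"
  shows "asymp_iter_entropy X f = log 2 (real c)"
proof -
  have "(\<Sum>T\<in>components X f. real (card T) * log 2 (real (card (component_cycle X f T))))
      = real (card X) * log 2 (real c)"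
    by (simp add: assms(1) sum_card_components flip: sum_distrib_right)
  then show ?thesis
    using assms(2) finite_X by (simp add: asymp_iter_entropy_def)
qed

text \<open>Since cycles fill their components, a component of size t contributes (t/n) * (log t +
  log (n/t)) = (t/n) * log n, and the sizes sum to n.\<close>

lemma asymp_entropy_shannon:
  assumes "X \<noteq> {}" "bij_betw f X X"
  shows "asymp_iter_entropy X f
    + shannon_entropy (components X f) (\<lambda>T. real (card (component_cycle X f T)) / real (card X))
    = log 2 (real (card X))"
proof -
  define n where "n = real (card X)"
  have "0 < n" using assms finite_X by (auto simp: n_def card_gt_0_iff)
  have "asymp_iter_entropy X f
      + shannon_entropy (components X f) (\<lambda>T. real (card (component_cycle X f T)) / n)
    = (\<Sum>T\<in>components X f. real (card T) / n * log 2 (real (card T))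
        + real (card T) / n * log 2 (n / real (card T)))"
    using component_cycle_bij[OF assms(2)]
    by (simp add: asymp_iter_entropy_def shannon_entropy_def sum.distrib sum_divide_distrib n_def)
  also have "\<dots> = (\<Sum>T\<in>components X f. real (card T) * (log 2 n / n))"
  proof (rule sum.cong)
    fix T assume T: "T \<in> components X f"
    then have "0 < card T" using finite_component component_nonempty by (auto simp: card_gt_0_iff)
    then show "real (card T) / n * log 2 (real (card T)) + real (card T) / n * log 2 (n / real (card T))
        = real (card T) * (log 2 n / n)"
      using \<open>0 < n\<close> by (simp add: log_divide field_simps)
  qed simp
  also have "\<dots> = log 2 n"
    unfolding sum_distrib_right[symmetric] sum_card_components n_def[symmetric]
    using \<open>0 < n\<close> by simp
  finally show ?thesis by (simp add: n_def)
qed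

lemma asymp_entropy_nonneg: "0 \<le> asymp_iter_entropy X f"
  unfolding asymp_iter_entropy_def using card_component_cycle(1)
  by (intro mult_nonneg_nonneg sum_nonneg) (auto simp: zero_le_log_cancel_iff Suc_le_eq)

lemma log_component_cycle_le:
  assumes "T \<in> components X f"
  shows "log 2 (real (card (component_cycle X f T))) \<le> log 2 (real (card X))"
  using card_component_cycle[OF assms] by (subst log_le_cancel_iff) auto

text \<open>Writing log n as an average over components turns the gap into a sum of nonnegative
  terms. This yields both the upper bound and its equality case.\<close>

lemma asymp_entropy_deficit:
  assumes "X \<noteq> {}"
  shows "log 2 (real (card X)) - asymp_iter_entropy X f =
    (\<Sum>T\<in>components X f. real (card T)
        * (log 2 (real (card X)) - log 2 (real (card (component_cycle X f T))))) / real (card X)"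
  using assms finite_X sum_card_components
  by (simp add: asymp_iter_entropy_def right_diff_distrib sum_subtractf diff_divide_distrib
      flip: sum_distrib_right)

lemma asymp_entropy_le:
  assumes "X \<noteq> {}"
  shows "asymp_iter_entropy X f \<le> log 2 (real (card X))"
proof -
  have "0 \<le> log 2 (real (card X)) - asymp_iter_entropy X f"
    unfolding asymp_entropy_deficit[OF assms]
    by (intro divide_nonneg_nonneg sum_nonneg mult_nonneg_nonneg) (auto simp: log_component_cycle_le)
  then show ?thesis by simp
qed

lemma cyclic_on_imp_bij_betw:
  assumes "cyclic_on f X"
  shows "bij_betw f X X"
proof -
  have "X \<subseteq> f ` X"
  proof
    fix y assume "y \<in> X"
    then have "y \<in> orbit f y" and X: "X = orbit f y"
      using assms by (auto simp: cyclic_on_alldef)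
    \<comment> \<open>An element of an orbit is the image of the starting point or of another orbit
      element; here both lie in \<open>X\<close>. Surjectivity on a finite set then gives
      injectivity.\<close>
    then show "y \<in> f ` X"
      by (cases rule: orbit.cases) (use X \<open>y \<in> X\<close> in auto)
  qed
  then have "f ` X = X" using f_in by auto
  then show ?thesis
    using finite_X by (simp add: bij_betw_def eq_card_imp_inj_on)
qed

lemma asymp_entropy_cyclic:
  assumes "cyclic_on f X"
  shows "asymp_iter_entropy X f = log 2 (real (card X))"
proof (rule asymp_entropy_const)
  show "X \<noteq> {}" using assms by (simp add: cyclic_on_alldef)
  fix T assume T: "T \<in> components X f"
  then obtain x where x: "x \<in> T" using component_nonempty by blast
  then have "orbit f x = X" "x \<in> X"
    using assms component_subset[OF T] orbit_cyclic_eq3[OF assms] by auto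
  then show "card (component_cycle X f T) = card X"
    using component_cycle_eqI[OF T x] by simp
qed

text \<open>A vanishing gap forces each of its nonnegative terms to vanish. A single component then
  suffices: its cycle has \<open>card X\<close> elements, hence is all of \<open>X\<close>.\<close>

lemma asymp_entropy_max_iff:
  assumes "X \<noteq> {}"
  shows "asymp_iter_entropy X f = log 2 (real (card X)) \<longleftrightarrow> bij_betw f X X \<and> cyclic_on f X"
proof (intro iffI)
  assume "asymp_iter_entropy X f = log 2 (real (card X))"
  then have "(\<Sum>T\<in>components X f. real (card T)
        * (log 2 (real (card X)) - log 2 (real (card (component_cycle X f T))))) = 0"
    using asymp_entropy_deficit[OF assms] assms finite_X by simp
  then have zero: "real (card T)
        * (log 2 (real (card X)) - log 2 (real (card (component_cycle X f T)))) = 0"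
    if "T \<in> components X f" for T
    using that finite_components log_component_cycle_le
    by (subst (asm) sum_nonneg_eq_0_iff) auto
  obtain T where T: "T \<in> components X f"
    using assms Union_components by blast
  \<comment> \<open>The factor \<open>card T\<close> can be cancelled, being at least the cycle
    length and hence positive.\<close>
  have "log 2 (real (card X)) = log 2 (real (card (component_cycle X f T)))"
    using zero[OF T] card_component_cycle(1,2)[OF T] by auto
  then have "card X = card (component_cycle X f T)"
    using card_component_cycle[OF T] by (subst (asm) inj_on_eq_iff[OF log_inj]) auto
  moreover have "component_cycle X f T \<subseteq> X"
    using component_cycle(2)[OF T] component_subset[OF T] by blast
  ultimately have "component_cycle X f T = X"
    using finite_X by (simp add: card_subset_eq)
  then have "cyclic_on f X"
    using component_cycle(1)[OF T] unfolding cycle_sets_eq_orbits[OF f_in] cyclic_on_def by auto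
  then show "bij_betw f X X \<and> cyclic_on f X"
    using cyclic_on_imp_bij_betw by simp
qed (simp add: asymp_entropy_cyclic)

lemma asymp_entropy_id:
  assumes "X \<noteq> {}" "\<forall>x\<in>X. f x = x"
  shows "asymp_iter_entropy X f = 0"
proof -
  have "card (component_cycle X f T) = 1" if T: "T \<in> components X f" for T
  proof -
    obtain x where x: "x \<in> T" using T component_nonempty by blast
    then have "orbit f x = {x}"
      using assms component_subset[OF T] by (auto simp: orbit_eq_singleton_iff)
    then show ?thesis using component_cycle_eqI[OF T x] by simp
  qed
  from asymp_entropy_const[OF this assms(1)] show ?thesis by simp
qed

end

theorem theorem2:
  fixes X :: "'a set" and f :: "'a \<Rightarrow> 'a" and n k :: nat
  assumes "finite X" and "card X = n" and "f \<in> X \<rightarrow> X"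
    and "k \<ge> 4 * n" and "4 * n \<ge> 77"
  shows
    "\<bar>iter_entropy X f k - asymp_iter_entropy X f\<bar> \<le> 4 * real n * log 2 (real k) / real k
    \<and> (bij_betw f X X \<longrightarrow>
        (\<forall>T\<in>components X f. card (component_cycle X f T) = card T)
        \<and> \<bar>iter_entropy X f k - asymp_iter_entropy X f\<bar> \<le> 3 * real n * log 2 (real n) / real k
        \<and> asymp_iter_entropy X f
            + shannon_entropy (components X f)
                (\<lambda>T. real (card (component_cycle X f T)) / real n) = log 2 (real n))
    \<and> (bij_betw f X X \<and> cyclic_on f X \<longrightarrow> asymp_iter_entropy X f = log 2 (real n))
    \<and> ((\<forall>x\<in>X. f x = x) \<longrightarrow> asymp_iter_entropy X f = 0)
    \<and> (bij_betw f X X \<and> (LCM T\<in>components X f. card (component_cycle X f T)) dvd k \<longrightarrow>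
        iter_entropy X f k = asymp_iter_entropy X f)
    \<and> 0 \<le> asymp_iter_entropy X f
    \<and> asymp_iter_entropy X f \<le> log 2 (real n)
    \<and> (asymp_iter_entropy X f = log 2 (real n) \<longleftrightarrow> bij_betw f X X \<and> cyclic_on f X)"
proof -
  interpret finite_self_map X f
    using assms by unfold_locales
  \<comment> \<open>The size assumptions enter through n \<ge> 2, giving log n \<ge> 1, and k \<ge>
    4, giving log k \<ge> 2.\<close>
  have n: "card X = n" "X \<noteq> {}" "2 \<le> card X" and k: "0 < k" "4 \<le> k"
    using assms by auto
  show ?thesis
    using entropy_error[OF k(2) n(2)] entropy_error_bij[OF k(1) n(3)] entropy_bij_eq[OF k(1) n(2)]
      component_cycle_bij asymp_entropy_shannon[OF n(2)] asymp_entropy_id[OF n(2)]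
      asymp_entropy_nonneg asymp_entropy_le[OF n(2)] asymp_entropy_max_iff[OF n(2)]
    unfolding n(1) by auto
qed

end
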